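(* Let $f:\mathbb R^n\to\mathbb R^n$ be a linear endomorphism with matrix $A\in\mathcal M_n(\mathbb R)$ in the canonical basis, and for each natural number $p$ let $f^{(p)}$ be its $\varphi_p$-linear transformation. If $|A|_\infty\neq0$, then there is some $p_0\in\mathbb N$ such that for all $p\ge p_0$, $f^{(p)}$ is $\varphi_p$-invertible and for all $b\in\mathbb R^n$ there exists a solution $x^{(p)}$ to the system $A\stackrel{p}{\cdot}x=b$, with $$x^{(p)}_i=\frac{|A^{(i)}|_p}{|A|_p}=\frac{\big|\Phi_p(A^{(i)})\big|^{\frac1{2p+1}}}{\big|\Phi_p(A)\big|^{\frac1{2p+1}}}\qquad(i\in[n]),$$ where $A^{(i)}$ is the matrix obtained from $A$ by replacing column $i$ with $b$. Moreover $$\lim_{p\to\infty}x^{(p)}=x^\star,\qquad\text{with}\qquad x^\star_i=\frac{|A^{(i)}|_\infty}{|A|_\infty}\quad\text{for all }i\in[n].$$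
   Context: $[n]=\{1,\dots,n\}$; $|M|$ is the ordinary determinant of a square matrix $M$; $t^{1/(2p+1)}$ is the real odd root. For a natural number $p$: $\phi_p(x)=(x_1^{2p+1},\dots,x_n^{2p+1})$ for $x\in\mathbb R^n$, $\Phi_p(A)=(a_{i,j}^{2p+1})_{i,j}$, $A\stackrel{p}{\cdot}x=\phi_p^{-1}(\Phi_p(A)\phi_p(x))$, that is, $(A\stackrel{p}{\cdot}x)_i=(\sum_{j}a_{i,j}^{2p+1}x_j^{2p+1})^{1/(2p+1)}$. The $\varphi_p$-linear transformation of $f$ is $f^{(p)}(x)=A\stackrel{p}{\cdot}x$; it is $\varphi_p$-invertible if and only if $\Phi_p(A)$ is invertible. The $\varphi_p$-determinant is $|A|_p=|\Phi_p(A)|^{1/(2p+1)}$. Determinant in limit: $|A|_\infty=\mathop{\boxplus}_{\sigma\in S_n}\big(\operatorname{sgn}(\sigma)\prod_{i\in[n]}a_{i,\sigma(i)}\big)$, where for a finite family of reals $(x_i)_{i\in I}$ the value $\mathop{\boxplus}_{i\in I}x_i$ is defined as follows. For $\alpha>0$ put $\xi(\alpha)=\mathrm{Card}\{i:x_i=\alpha\}-\mathrm{Card}\{i:x_i=-\alpha\}$. If $\xi(\alpha)=0$ for all $\alpha>0$, then $\mathop{\boxplus}_{i\in I}x_i=0$. Otherwise let $\alpha^\star$ be the largest $\alpha>0$ with $\xi(\alpha)\ne0$; then $\mathop{\boxplus}_{i\in I}x_i=\alpha^\star$ if $\xi(\alpha^\star)>0$ and $-\alpha^\star$ if $\xi(\alpha^\star)<0$.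 *)

theory Defs
  imports "HOL-Analysis.Analysis"
begin

definition phi :: "nat \<Rightarrow> real ^ 'n \<Rightarrow> real ^ 'n" where
  "phi p x = (\<chi> i. (x $ i) ^ (2 * p + 1))"

definition Phi :: "nat \<Rightarrow> real ^ 'n ^ 'm \<Rightarrow> real ^ 'n ^ 'm" where
  "Phi p A = (\<chi> i j. (A $ i $ j) ^ (2 * p + 1))"

definition phi_mult :: "nat \<Rightarrow> real ^ 'n ^ 'n \<Rightarrow> real ^ 'n \<Rightarrow> real ^ 'n" where
  "phi_mult p A x = inv (phi p) (Phi p A *v phi p x)"

definition phi_transform ::
    "nat \<Rightarrow> (real ^ 'n \<Rightarrow> real ^ 'n) \<Rightarrow> real ^ 'n \<Rightarrow> real ^ 'n" where
  "phi_transform p f = (\<lambda>x. phi_mult p (matrix f) x)"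

text \<open>A map is invertible in the sense of exponent \<open>2 * p + 1\<close> if it has a two-sided inverse
  of the form \<open>phi_mult p B\<close>.  For \<open>phi_transform p f\<close> this is the same as invertibility of
  \<open>Phi p (matrix f)\<close>; see \<open>phi_invertible_iff\<close> below.\<close>

definition phi_invertible :: "nat \<Rightarrow> (real ^ 'n \<Rightarrow> real ^ 'n) \<Rightarrow> bool" where
  "phi_invertible p g \<longleftrightarrow>
     (\<exists>B. (\<forall>x. phi_mult p B (g x) = x) \<and> (\<forall>x. g (phi_mult p B x) = x))"

definition phi_det :: "nat \<Rightarrow> real ^ 'n ^ 'n \<Rightarrow> real" where
  "phi_det p A = root (2 * p + 1) (det (Phi p A))"

definition xi :: "'i set \<Rightarrow> ('i \<Rightarrow> real) \<Rightarrow> real \<Rightarrow> int" where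
  "xi I x \<alpha> = int (card {i \<in> I. x i = \<alpha>}) - int (card {i \<in> I. x i = - \<alpha>})"

text \<open>Only meaningful for finite \<open>I\<close>, in which case the set under \<open>Max\<close> is finite
  (\<open>finite_xi_support\<close>) and, in the branch where it is used, nonempty.\<close>

definition boxplus :: "'i set \<Rightarrow> ('i \<Rightarrow> real) \<Rightarrow> real" where
  "boxplus I x =
     (if \<forall>\<alpha>>0. xi I x \<alpha> = 0 then 0
      else let \<alpha> = Max {\<alpha>. \<alpha> > 0 \<and> xi I x \<alpha> \<noteq> 0}
           in if xi I x \<alpha> > 0 then \<alpha> else - \<alpha>)"

definition det_inf :: "real ^ 'n ^ 'n \<Rightarrow> real" where
  "det_inf A = boxplus {\<sigma>. \<sigma> permutes (UNIV :: 'n set)}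
     (\<lambda>\<sigma>. of_int (sign \<sigma>) * (\<Prod>i\<in>UNIV. A $ i $ \<sigma> i))"

definition replace_col :: "real ^ 'n ^ 'n \<Rightarrow> 'n \<Rightarrow> real ^ 'n \<Rightarrow> real ^ 'n ^ 'n" where
  "replace_col A i b = (\<chi> k l. if l = i then b $ k else A $ k $ l)"

lemma finite_xi_support:
  assumes "finite I"
  shows "finite {\<alpha>. \<alpha> > 0 \<and> xi I x \<alpha> \<noteq> 0}"
proof (rule finite_subset)
  show "{\<alpha>. \<alpha> > 0 \<and> xi I x \<alpha> \<noteq> 0} \<subseteq> (\<lambda>i. \<bar>x i\<bar>) ` I"
  proof
    fix \<alpha> assume "\<alpha> \<in> {\<alpha>. \<alpha> > 0 \<and> xi I x \<alpha> \<noteq> 0}"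
    then have "\<alpha> > 0" and "{i \<in> I. x i = \<alpha>} \<noteq> {} \<or> {i \<in> I. x i = - \<alpha>} \<noteq> {}"
      by (auto simp: xi_def simp del: Collect_empty_eq)
    then show "\<alpha> \<in> (\<lambda>i. \<bar>x i\<bar>) ` I"
      by force
  qed
qed (use assms in simp)

lemma phi_root: "phi p (\<chi> i. root (2 * p + 1) (y $ i)) = y"
  by (simp only: phi_def vec_eq_iff vec_lambda_beta) (simp add: odd_real_root_pow del: power_Suc)

lemma root_phi: "(\<chi> i. root (2 * p + 1) (phi p x $ i)) = x"
  by (simp only: phi_def vec_eq_iff vec_lambda_beta) (simp add: odd_real_root_power_cancel del: power_Suc)

lemma bij_phi: "bij (phi p)"
  by (rule o_bij[of "\<lambda>y. \<chi> i. root (2 * p + 1) (y $ i)"])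
     (simp_all add: fun_eq_iff phi_root root_phi del: One_nat_def)

lemma inv_phi: "inv (phi p) y = (\<chi> i. root (2 * p + 1) (y $ i))"
  by (metis bij_phi bij_is_inj inv_f_f phi_root)

lemma phi_mult_nth:
  "phi_mult p A x $ i =
     root (2 * p + 1) (\<Sum>j\<in>UNIV. (A $ i $ j) ^ (2 * p + 1) * (x $ j) ^ (2 * p + 1))"
  by (simp only: phi_mult_def inv_phi vec_lambda_beta matrix_vector_mult_def Phi_def phi_def)

lemma phi_phi_mult: "phi p (phi_mult p A x) = Phi p A *v phi p x"
  by (simp add: phi_mult_def bij_phi bij_is_surj surj_f_inv_f)

lemma Phi_surj: "\<exists>B. Phi p B = C"
proof
  show "Phi p (\<chi> i j. root (2 * p + 1) (C $ i $ j)) = C"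
    by (simp only: Phi_def vec_eq_iff vec_lambda_beta) (simp add: odd_real_root_pow del: power_Suc)
qed

lemma phi_mult_inverse_iff:
  "(\<forall>x. phi_mult p B (phi_mult p A x) = x) \<longleftrightarrow> Phi p B ** Phi p A = mat 1"
proof -
  have "(\<forall>x. phi_mult p B (phi_mult p A x) = x) \<longleftrightarrow>
        (\<forall>x. (Phi p B ** Phi p A) *v phi p x = phi p x)"
    by (metis bij_phi bij_is_inj injD phi_phi_mult matrix_vector_mul_assoc)
  also have "\<dots> \<longleftrightarrow> (\<forall>y. (Phi p B ** Phi p A) *v y = y)"
    by (metis phi_root)
  also have "\<dots> \<longleftrightarrow> Phi p B ** Phi p A = mat 1"
    by (metis matrix_eq matrix_vector_mul_lid)
  finally show ?thesis .
qed

lemma phi_invertible_iff: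
  "phi_invertible p (phi_transform p f) \<longleftrightarrow> invertible (Phi p (matrix f))"
  unfolding phi_invertible_def phi_transform_def phi_mult_inverse_iff invertible_def
  by (metis Phi_surj)

end

theory Submission
  imports Defs "HOL-Real_Asymp.Real_Asymp"
begin

text \<open>
  The operation \<open>boxplus\<close> is the limit of the odd power sums
  \<open>root (2 * p + 1) (\<Sum>i\<in>I. x i ^ (2 * p + 1))\<close>. Since the exponent is odd, the terms
  \<open>\<alpha>\<close> and \<open>- \<alpha>\<close> cancel exactly, and the power sum equals
  \<open>\<Sum>\<alpha>. xi I x \<alpha> * \<alpha> ^ (2 * p + 1)\<close>, taken over the absolute values \<open>\<alpha> > 0\<close> for which
  \<open>xi I x \<alpha> \<noteq> 0\<close>. The largest of these dominates, and the root turns its integer coefficient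
  into a sign, because roots of growing order send every nonzero number to \<open>1\<close> or \<open>-1\<close>.
  This is \<open>boxplus_limit\<close>.

  Odd powers are multiplicative and fix the signs of permutations, so the determinant of
  \<open>Phi p A\<close> is the odd power sum of the terms of the Leibniz expansion of \<open>det A\<close>. Hence
  \<open>phi_det p A\<close> tends to \<open>det_inf A\<close> for every matrix \<open>A\<close> (\<open>phi_det_limit\<close>). If
  \<open>det_inf A \<noteq> 0\<close>, then \<open>Phi p A\<close> is therefore invertible for all large \<open>p\<close>, with a bound
  that involves \<open>A\<close> alone and so serves every right-hand side. Cramer's rule for \<open>Phi p A\<close>,
  transported through the bijection \<open>phi p\<close>, yields the solutions (\<open>phi_cramer\<close>); their
  limits are those of the numerators and of the denominator.
\<close>

lemma sum_odd_power_eq_sum_xi: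
  fixes x :: "'i \<Rightarrow> real"
  assumes "finite I" and "odd n"
  shows "(\<Sum>i\<in>I. x i ^ n) =
    (\<Sum>\<alpha> | \<alpha> > 0 \<and> xi I x \<alpha> \<noteq> 0. of_int (xi I x \<alpha>) * \<alpha> ^ n)"
proof -
  let ?T = "(\<lambda>i. \<bar>x i\<bar>) ` I"
  let ?S = "{\<alpha>. \<alpha> > 0 \<and> xi I x \<alpha> \<noteq> 0}"
  have level: "(\<Sum>i | i \<in> I \<and> \<bar>x i\<bar> = \<alpha>. x i ^ n) = of_int (xi I x \<alpha>) * \<alpha> ^ n"
    if "\<alpha> \<ge> 0" for \<alpha>
  proof (cases "\<alpha> = 0")
    case True
    then show ?thesis using assms by (auto simp: odd_pos intro!: sum.neutral)
  next
    case False
    with that have "\<alpha> > 0" by simp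
    let ?P = "{i \<in> I. x i = \<alpha>}" and ?N = "{i \<in> I. x i = - \<alpha>}"
    have "{i \<in> I. \<bar>x i\<bar> = \<alpha>} = ?P \<union> ?N" and "?P \<inter> ?N = {}"
      using \<open>\<alpha> > 0\<close> by auto
    then have "(\<Sum>i | i \<in> I \<and> \<bar>x i\<bar> = \<alpha>. x i ^ n) = (\<Sum>i\<in>?P. x i ^ n) + (\<Sum>i\<in>?N. x i ^ n)"
      using assms(1) by (simp add: sum.union_disjoint)
    also have "\<dots> = real (card ?P) * \<alpha> ^ n - real (card ?N) * \<alpha> ^ n"
      using assms(2) by simp
    finally show ?thesis by (simp add: xi_def left_diff_distrib)
  qed
  have "(\<Sum>i\<in>I. x i ^ n) = (\<Sum>\<alpha>\<in>?T. \<Sum>i | i \<in> I \<and> \<bar>x i\<bar> = \<alpha>. x i ^ n)"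
    using assms(1) by (intro sum.group[symmetric]) auto
  also have "\<dots> = (\<Sum>\<alpha>\<in>?T. of_int (xi I x \<alpha>) * \<alpha> ^ n)"
    by (intro sum.cong refl level) auto
  also have "\<dots> = (\<Sum>\<alpha>\<in>?S. of_int (xi I x \<alpha>) * \<alpha> ^ n)"
  proof (rule sum.mono_neutral_right)
    show "?S \<subseteq> ?T"
    proof
      fix \<alpha> assume "\<alpha> \<in> ?S"
      then have "\<alpha> > 0" and "{i \<in> I. x i = \<alpha>} \<noteq> {} \<or> {i \<in> I. x i = - \<alpha>} \<noteq> {}"
        by (auto simp: xi_def simp del: Collect_empty_eq)
      then show "\<alpha> \<in> ?T" by force
    qed
    show "\<forall>\<alpha>\<in>?T - ?S. of_int (xi I x \<alpha>) * \<alpha> ^ n = 0"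
      using assms(2) by (auto simp: odd_pos xi_def)
  qed (use assms(1) in simp)
  finally show ?thesis .
qed

lemma root_odd_tendsto_sgn:
  fixes c :: "nat \<Rightarrow> real"
  assumes "c \<longlonglongrightarrow> l" and "l \<noteq> 0"
  shows "(\<lambda>p. root (2 * p + 1) (c p)) \<longlonglongrightarrow> sgn l"
proof -
  have pos: "(\<lambda>p. root (2 * p + 1) (d p)) \<longlonglongrightarrow> 1"
    if d: "d \<longlonglongrightarrow> m" and "m > 0" for d :: "nat \<Rightarrow> real" and m
  proof -
    have "(\<lambda>p. 1 / real (2 * p + 1)) \<longlonglongrightarrow> 0"
      by real_asymp
    then have "(\<lambda>p. d p powr (1 / real (2 * p + 1))) \<longlonglongrightarrow> m powr 0"
      using d \<open>m > 0\<close> by (intro tendsto_powr) auto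
    moreover have "\<forall>\<^sub>F p in sequentially. d p powr (1 / real (2 * p + 1)) = root (2 * p + 1) (d p)"
      using order_tendstoD(1)[OF d \<open>m > 0\<close>]
      by eventually_elim (simp only: root_powr_inverse)
    ultimately show ?thesis
      using \<open>m > 0\<close> by (simp add: filterlim_cong)
  qed
  show ?thesis
  proof (cases "l > 0")
    case True
    then show ?thesis using pos assms(1) by simp
  next
    case False
    then have "(\<lambda>p. root (2 * p + 1) (- c p)) \<longlonglongrightarrow> 1"
      using assms by (intro pos[where m = "- l"] tendsto_minus) auto
    then have "(\<lambda>p. - root (2 * p + 1) (- c p)) \<longlonglongrightarrow> - 1"
      by (rule tendsto_minus)
    then show ?thesis using False assms(2) by (simp add: real_root_minus)
  qed
qed

text \<open>
  After division by \<open>a ^ (2 * p + 1)\<close>, where \<open>a\<close> is the largest absolute value that does not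
  cancel, all other terms of the regrouped power sum decay geometrically.
\<close>

lemma boxplus_limit:
  fixes x :: "'i \<Rightarrow> real"
  assumes "finite I"
  shows "(\<lambda>p. root (2 * p + 1) (\<Sum>i\<in>I. x i ^ (2 * p + 1))) \<longlonglongrightarrow> boxplus I x"
proof -
  let ?S = "{\<alpha>. \<alpha> > 0 \<and> xi I x \<alpha> \<noteq> 0}"
  have expand: "(\<Sum>i\<in>I. x i ^ (2 * p + 1)) = (\<Sum>\<alpha>\<in>?S. of_int (xi I x \<alpha>) * \<alpha> ^ (2 * p + 1))"
    for p
    by (rule sum_odd_power_eq_sum_xi[OF assms]) simp
  have fin: "finite ?S" by (rule finite_xi_support[OF assms])
  show ?thesis
  proof (cases "?S = {}")
    case True
    then have "boxplus I x = 0" by (auto simp: boxplus_def)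
    with True show ?thesis by (simp only: expand sum.empty real_root_zero tendsto_const)
  next
    case False
    define a where "a = Max ?S"
    have "a \<in> ?S" unfolding a_def using fin False by (rule Max_in)
    then have "a > 0" and xi_a: "xi I x a \<noteq> 0" by auto
    have small: "\<alpha> < a" if "\<alpha> \<in> ?S - {a}" for \<alpha>
      using that fin Max_ge[of ?S \<alpha>] by (auto simp: a_def less_le)
    define r where "r p = (\<Sum>\<alpha>\<in>?S. of_int (xi I x \<alpha>) * (\<alpha> / a) ^ (2 * p + 1))" for p
    have odd_order: "filterlim (\<lambda>p::nat. 2 * p + 1) sequentially sequentially"
      by (rule filterlim_subseq) (simp add: strict_mono_def)
    have "(\<lambda>p. \<Sum>\<alpha>\<in>?S - {a}. of_int (xi I x \<alpha>) * (\<alpha> / a) ^ (2 * p + 1)) \<longlonglongrightarrow> 0"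
    proof (intro tendsto_null_sum tendsto_mult_right_zero)
      fix \<alpha> assume \<alpha>: "\<alpha> \<in> ?S - {a}"
      then have "norm (\<alpha> / a) < 1" using small[OF \<alpha>] \<open>a > 0\<close> by simp
      from filterlim_compose[OF LIMSEQ_power_zero[OF this] odd_order]
      show "(\<lambda>p. (\<alpha> / a) ^ (2 * p + 1)) \<longlonglongrightarrow> 0" .
    qed
    from tendsto_add[OF tendsto_const[of "of_int (xi I x a)"] this]
    have "r \<longlonglongrightarrow> of_int (xi I x a)"
      unfolding r_def using \<open>a > 0\<close> by (simp add: sum.remove[OF fin \<open>a \<in> ?S\<close>])
    then have "(\<lambda>p. root (2 * p + 1) (r p)) \<longlonglongrightarrow> sgn (of_int (xi I x a))"
      using xi_a by (intro root_odd_tendsto_sgn) auto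
    then have "(\<lambda>p. a * root (2 * p + 1) (r p)) \<longlonglongrightarrow> a * sgn (of_int (xi I x a))"
      by (rule tendsto_mult_left)
    moreover have "root (2 * p + 1) (\<Sum>i\<in>I. x i ^ (2 * p + 1)) = a * root (2 * p + 1) (r p)" for p
    proof -
      have "(\<Sum>i\<in>I. x i ^ (2 * p + 1)) = a ^ (2 * p + 1) * r p"
        unfolding expand r_def sum_distrib_left
        using \<open>a > 0\<close> by (intro sum.cong refl) (simp add: power_divide)
      moreover have "root (2 * p + 1) (a ^ (2 * p + 1)) = a"
        by (rule odd_real_root_power_cancel) simp
      ultimately show ?thesis by (simp only: real_root_mult)
    qed
    moreover have "boxplus I x = a * sgn (of_int (xi I x a))"
      using False xi_a by (auto simp: boxplus_def Let_def a_def[symmetric] sgn_if)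
    ultimately show ?thesis by simp
  qed
qed

lemma det_Phi:
  fixes A :: "real ^ 'n ^ 'n"
  shows "det (Phi p A) = (\<Sum>\<sigma> | \<sigma> permutes (UNIV :: 'n set).
    (of_int (sign \<sigma>) * (\<Prod>i\<in>UNIV. A $ i $ \<sigma> i)) ^ (2 * p + 1))"
proof -
  have "(of_int (sign \<sigma>) :: real) ^ (2 * p + 1) = of_int (sign \<sigma>)" for \<sigma> :: "'n \<Rightarrow> 'n"
    by (simp add: sign_def)
  then show ?thesis
    by (simp only: det_def Phi_def vec_lambda_beta power_mult_distrib prod_power_distrib)
qed

lemma phi_det_limit:
  fixes A :: "real ^ 'n ^ 'n"
  shows "(\<lambda>p. phi_det p A) \<longlonglongrightarrow> det_inf A"
  unfolding phi_det_def det_Phi det_inf_def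
  by (rule boxplus_limit) (simp add: finite_permutations)

lemma phi_det_eq_0_iff: "phi_det p A = 0 \<longleftrightarrow> det (Phi p A) = 0"
  by (simp add: phi_det_def)

lemma phi_det_power: "phi_det p A ^ (2 * p + 1) = det (Phi p A)"
  unfolding phi_det_def by (rule odd_real_root_pow) simp

lemma Phi_replace_col: "Phi p (replace_col A i b) = replace_col (Phi p A) i (phi p b)"
  by (simp add: vec_eq_iff Phi_def replace_col_def phi_def)

text \<open>
  Applying \<open>phi p\<close> turns the system \<open>phi_mult p A x = b\<close> into the linear system with matrix
  \<open>Phi p A\<close>, unknown \<open>phi p x\<close> and right-hand side \<open>phi p b\<close>; since \<open>Phi p\<close> commutes with the
  replacement of a column, the classical Cramer quotients are odd powers of those below.
\<close>

lemma phi_cramer: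
  fixes A :: "real ^ 'n ^ 'n"
  assumes "phi_det p A \<noteq> 0"
  shows "phi_mult p A (\<chi> i. phi_det p (replace_col A i b) / phi_det p A) = b"
    (is "phi_mult p A ?x = b")
proof -
  have "phi p ?x = (\<chi> i. det (replace_col (Phi p A) i (phi p b)) / det (Phi p A))"
    by (simp only: phi_def[of p ?x] vec_lambda_beta power_divide phi_det_power Phi_replace_col)
  moreover have "det (Phi p A) \<noteq> 0"
    using assms by (simp add: phi_det_eq_0_iff)
  ultimately have "Phi p A *v phi p ?x = phi p b"
    by (simp add: cramer replace_col_def)
  then show ?thesis
    by (simp add: phi_mult_def bij_phi bij_is_inj)
qed

theorem proposition3p2p3:
  fixes f :: "real ^ 'n \<Rightarrow> real ^ 'n" and A :: "real ^ 'n ^ 'n"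
  assumes "linear f" and "A = matrix f" and "det_inf A \<noteq> 0"
  shows "\<exists>p0. (\<forall>p\<ge>p0. phi_invertible p (phi_transform p f)) \<and>
    (\<forall>b. \<exists>x :: nat \<Rightarrow> real ^ 'n.
      (\<forall>p\<ge>p0. phi_mult p A (x p) = b \<and>
        (\<forall>i. x p $ i = phi_det p (replace_col A i b) / phi_det p A \<and>
             x p $ i = root (2 * p + 1) (det (Phi p (replace_col A i b)))
                       / root (2 * p + 1) (det (Phi p A)))) \<and>
      x \<longlonglongrightarrow> (\<chi> i. det_inf (replace_col A i b) / det_inf A))"
proof -
  have "\<forall>\<^sub>F p in sequentially. phi_det p A \<noteq> 0"
    by (rule tendsto_imp_eventually_ne[OF phi_det_limit assms(3)])
  then obtain p0 where p0: "phi_det p A \<noteq> 0" if "p \<ge> p0" for p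
    by (auto simp: eventually_sequentially)
  show ?thesis
  proof (intro exI[of _ p0] conjI allI impI)
    fix p assume "p \<ge> p0"
    then show "phi_invertible p (phi_transform p f)"
      using p0 assms(2) by (simp add: phi_invertible_iff invertible_det_nz phi_det_eq_0_iff)
  next
    fix b :: "real ^ 'n"
    let ?x = "\<lambda>p. \<chi> i. phi_det p (replace_col A i b) / phi_det p A"
    have "?x \<longlonglongrightarrow> (\<chi> i. det_inf (replace_col A i b) / det_inf A)"
      by (intro tendsto_vec_lambda tendsto_divide phi_det_limit assms(3))
    moreover have "phi_mult p A (?x p) = b" if "p \<ge> p0" for p
      using that by (intro phi_cramer p0)
    ultimately show "\<exists>x. (\<forall>p\<ge>p0. phi_mult p A (x p) = b \<and>
        (\<forall>i. x p $ i = phi_det p (replace_col A i b) / phi_det p A \<and>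
             x p $ i = root (2 * p + 1) (det (Phi p (replace_col A i b)))
                       / root (2 * p + 1) (det (Phi p A)))) \<and>
      x \<longlonglongrightarrow> (\<chi> i. det_inf (replace_col A i b) / det_inf A)"
      by (intro exI[of _ ?x]) (simp add: phi_det_def)
  qed
qed

end
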